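(* Let $d\ge1$ be an integer and $s\in[0,1]$. Then $$d\,\mathrm{B}_s(d,d)\sqrt{1-(\mathrm{I}_s(d,d))^{1/d}}\ \ge\ s^d(1-s)^d,$$ with equality if and only if $s=0$ or $s=1$.
   Context: $\mathrm{B}_x(a,b)=\int_0^x t^{a-1}(1-t)^{b-1}\,dt$ is Euler's incomplete Beta function, $\mathrm{B}(a,b)=\mathrm{B}_1(a,b)$, and $\mathrm{I}_x(a,b)=\mathrm{B}_x(a,b)/\mathrm{B}(a,b)$ is its regularized version. *)

theory Defs
  imports "HOL-Analysis.Analysis"
begin

text \<open>
  Meant for a, b > 0 and 0 \<le> x \<le> 1.  The convention \<open>0 powr 0 = 0\<close> changes the integrand
  at the end points 0 and 1 only (and only for \<open>a = 1\<close> or \<open>b = 1\<close>), so the integral is unaffected.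
\<close>
definition inc_Beta :: "real \<Rightarrow> real \<Rightarrow> real \<Rightarrow> real" where
  "inc_Beta x a b = integral {0..x} (\<lambda>t. t powr (a - 1) * (1 - t) powr (b - 1))"

definition reg_inc_Beta :: "real \<Rightarrow> real \<Rightarrow> real \<Rightarrow> real" where
  "reg_inc_Beta x a b = inc_Beta x a b / Beta a b"

text \<open>
  \<open>Beta\<close> is defined in the library through the Gamma function; here is its description
  as the complete Beta integral.
\<close>
lemma inc_Beta_1:
  assumes "a > 0" "b > 0"
  shows "inc_Beta 1 a b = Beta a b"
  unfolding inc_Beta_def using has_integral_Beta_real[OF assms] by (rule integral_unique)

end

theory Submission
  imports Defs
begin

text \<open>
  Write \<open>F\<close> for the incomplete Beta integral, \<open>u = I\<^sub>s(d,d) powr (1/d)\<close> and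
  \<open>q = (s (1 - s))^d / (d F)\<close>; the claim is \<open>q\<^sup>2 + u < 1\<close> on the open unit interval.
  In the variable \<open>y = ln (s / (1 - s))\<close>, with \<open>m = 1 - 2 s\<close>, these functions satisfy
  \<open>q' = d q (m - q)\<close> and \<open>u' = u q\<close>.  A calculation gives \<open>d(q\<^sup>2 + u)/du = J\<close> with
  \<open>J = 1 - 2 d q (q - m) / u\<close>, and \<open>J' = d q K / u\<close> for a quadratic \<open>K\<close> in \<open>r = q - m\<close>.
  Positivity of \<open>K\<close> follows from a barrier argument, since
  \<open>K' = 2 (2 d + 1) r\<^sup>2 (m + (d + 1) r) - K ((3 d + 1) r + d m)\<close>.  Hence \<open>q\<^sup>2 + u\<close> is a strictly
  convex function of \<open>u\<close>, and it equals 1 at both end points.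
\<close>

section \<open>Barrier arguments for the differential system of \<open>q\<close> and
  \<open>u\<close>\<close>

text \<open>If \<open>g s \<le> 0\<close>, then \<open>g\<close> has a nonpositive minimum over
  \<open>{a..s}\<close> at a point other than \<open>a\<close>. The derivative is positive there, so
  \<open>g\<close> is still smaller slightly to the left, a contradiction.\<close>

lemma pos_if_deriv_pos_when_nonpos:
  fixes g :: "real \<Rightarrow> real"
  assumes cont: "continuous_on {a..b} g" and "g a = 0"
    and deriv: "\<And>x. x \<in> {a<..<b} \<Longrightarrow> g x \<le> 0 \<Longrightarrow> \<exists>D>0. (g has_real_derivative D) (at x)"
    and s: "s \<in> {a<..<b}"
  shows "g s > 0"
proof (rule ccontr)
  assume "\<not> g s > 0"
  then have gs: "g s \<le> 0" by simp
  have "continuous_on {a..s} g"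
    using cont by (rule continuous_on_subset) (use s in auto)
  then obtain t where t: "t \<in> {a..s}" and tmin: "\<And>x. x \<in> {a..s} \<Longrightarrow> g t \<le> g x"
    using continuous_attains_inf[of "{a..s}" g] s by force
  \<comment> \<open>If the minimum sits at \<open>a\<close>, then \<open>g s \<le> 0 = g a\<close>
    makes \<open>s\<close> itself a minimiser.\<close>
  obtain t' where t': "t' \<in> {a<..s}" and t'min: "\<And>x. x \<in> {a..s} \<Longrightarrow> g t' \<le> g x"
  proof (cases "t = a")
    case True
    then have "g s \<le> g x" if "x \<in> {a..s}" for x
      using tmin[OF that] gs \<open>g a = 0\<close> by simp
    then show ?thesis using that[of s] s by simp
  next
    case False
    then show ?thesis using t tmin that[of t] by simp
  qed
  have "g t' \<le> 0"
    using t'min[of s] gs s by simp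
  then obtain D where "D > 0" "(g has_real_derivative D) (at t')"
    using deriv[of t'] t' s by auto
  then obtain e where "e > 0" and e: "\<And>h. 0 < h \<Longrightarrow> h < e \<Longrightarrow> g (t' - h) < g t'"
    using DERIV_pos_inc_left by blast
  define h where "h = min (e/2) (t' - a)"
  have "0 < h" "h < e" "t' - h \<in> {a..s}"
    using \<open>e > 0\<close> t' by (auto simp: h_def)
  then show False
    using e[of h] t'min[of "t' - h"] by simp
qed

text \<open>The barrier lemma is applied twice, first to \<open>r\<close> and then to the quadratic,
  both of which vanish at 0. Wherever \<open>r \<le> 0\<close> its derivative is at least 2;
  positivity of \<open>r\<close> and \<open>q\<close> then fixes the signs needed for the
  quadratic.\<close>

lemma ode_quadratic_bound:
  fixes q :: "real \<Rightarrow> real" and d :: real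
  assumes "d \<ge> 1" and contq: "continuous_on {0..1} q" and "q 0 = 1"
    and qpos: "\<And>s. s \<in> {0<..<1} \<Longrightarrow> q s > 0"
    and qderiv: "\<And>s. s \<in> {0<..<1} \<Longrightarrow>
      (q has_real_derivative d * q s * (1 - 2 * s - q s) / (s * (1-s))) (at s)"
    and s: "s \<in> {0<..<1}"
  defines "r \<equiv> \<lambda>s. q s - (1 - 2 * s)"
  shows "2*(2*d+1) * r s ^ 2 + 2*(d+1) * (1-2 * s) * r s - 4 * s * (1-s) > 0"
proof -
  have rderiv: "(r has_real_derivative 2 - d * q s * r s / (s * (1-s))) (at s)"
    if "s \<in> {0<..<1}" for s
  proof -
    have "(r has_real_derivative d * q s * (1 - 2 * s - q s) / (s * (1-s)) - (0 - 2)) (at s)"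
      unfolding r_def
      by (intro DERIV_diff qderiv[OF that]) (auto intro!: derivative_eq_intros)
    moreover have "1 - 2 * s - q s = - r s" by (simp add: r_def)
    ultimately show ?thesis by simp
  qed
  have contr: "continuous_on {0..1} r"
    unfolding r_def by (intro continuous_intros contq)
  have rpos: "r s > 0" if "s \<in> {0<..<1}" for s
  proof (rule pos_if_deriv_pos_when_nonpos[OF contr _ _ that])
    show "r 0 = 0" using \<open>q 0 = 1\<close> by (simp add: r_def)
    fix x :: real assume x: "x \<in> {0<..<1}" "r x \<le> 0"
    then have "d * q x * r x / (x * (1-x)) \<le> 0"
      using qpos[of x] \<open>d \<ge> 1\<close>
      by (intro divide_nonpos_pos mult_nonneg_nonpos) auto
    then show "\<exists>D>0. (r has_real_derivative D) (at x)"
      using rderiv[OF x(1)] by (intro exI[of _ "2 - d * q x * r x / (x * (1-x))"]) auto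
  qed
  define K where "K = (\<lambda>s. 2*(2*d+1) * r s ^ 2 + 2*(d+1) * (1-2 * s) * r s - 4 * s * (1-s))"
  have "K s > 0"
  proof (rule pos_if_deriv_pos_when_nonpos[OF _ _ _ s])
    show "continuous_on {0..1} K"
      unfolding K_def by (intro continuous_intros contr)
    show "K 0 = 0" using \<open>q 0 = 1\<close> by (simp add: K_def r_def)
    fix x :: real assume x: "x \<in> {0<..<1}" "K x \<le> 0"
    let ?w = "x * (1-x)" and ?m = "1 - 2*x"
    have w: "?w > 0" using x by simp
    \<comment> \<open>\<open>D\<close> is the derivative of \<open>K\<close> in the variable
      \<open>y = ln (x / (1 - x))\<close>, hence \<open>?w\<close> times the derivative in
      \<open>x\<close>. The split isolates a multiple of \<open>K x\<close>, which contributes with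
      the right sign when \<open>K x \<le> 0\<close>.\<close>
    define D where "D = 2*(2*d+1) * r x ^ 2 * (?m + (d+1) * r x) - K x * ((3*d+1) * r x + d * ?m)"
    define R where "R = 2 - d * q x * r x / ?w"
    \<comment> \<open>Clearing the denominator gives a polynomial relation that
      \<open>algebra\<close> can work with.\<close>
    have R: "R * ?w = 2 * ?w - d * (r x + ?m) * r x"
    proof -
      have "R * ?w = 2 * ?w - d * q x * r x / ?w * ?w"
        by (simp only: R_def left_diff_distrib)
      also have "d * q x * r x / ?w * ?w = d * q x * r x"
        using w by (metis less_irrefl nonzero_eq_divide_eq)
      finally show ?thesis by (simp add: r_def)
    qed
    have "(r has_real_derivative R) (at x)"
      unfolding R_def by (rule rderiv[OF x(1)])
    then have "(K has_real_derivative
        (4*(2*d+1) * r x + 2*(d+1)*?m) * R - 4*(d+1)* r x - 4*?m) (at x)"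
      unfolding K_def
      by (auto intro!: derivative_eq_intros simp: algebra_simps)
    moreover have "(4*(2*d+1) * r x + 2*(d+1)*?m) * R - 4*(d+1)* r x - 4*?m = D / ?w"
    proof -
      have "((4*(2*d+1) * r x + 2*(d+1)*?m) * R - 4*(d+1)* r x - 4*?m) * ?w
          = (4*(2*d+1) * r x + 2*(d+1)*?m) * (R * ?w) - (4*(d+1)* r x + 4*?m) * ?w"
        by (simp only: left_diff_distrib distrib_right mult.assoc diff_diff_add)
      also have "\<dots> = D"
        unfolding R D_def K_def by algebra
      finally show ?thesis using w by (metis less_irrefl nonzero_eq_divide_eq)
    qed
    moreover have "D > 0"
    proof -
      have r: "r x > 0" and m: "r x + ?m > 0"
        using rpos[OF x(1)] qpos[OF x(1)] by (simp_all add: r_def)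
      \<comment> \<open>Since \<open>?m\<close> may be negative, both factors are expressed through
        \<open>r x + ?m = q x\<close>: they equal \<open>q x + d * r x\<close> and
        \<open>(2*d+1) * r x + d * q x\<close>.\<close>
      have "(r x + ?m) + d * r x > 0"
        using r \<open>d \<ge> 1\<close> by (intro add_pos_pos[OF m]) simp
      then have 1: "?m + (d+1) * r x > 0"
        by (simp add: algebra_simps)
      have "(2*d+1) * r x + d * (r x + ?m) > 0"
        using r m \<open>d \<ge> 1\<close> by (intro add_pos_pos mult_pos_pos[OF _ m] mult_pos_pos[OF _ r]) auto
      then have "(3*d+1) * r x + d * ?m > 0"
        by (simp add: algebra_simps)
      then have "K x * ((3*d+1) * r x + d * ?m) \<le> 0"
        using x(2) by (simp add: mult_nonpos_nonneg)
      moreover have "2*(2*d+1) * r x ^ 2 * (?m + (d+1) * r x) > 0"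
        using 1 r \<open>d \<ge> 1\<close> by simp
      ultimately show ?thesis unfolding D_def by linarith
    qed
    ultimately show "\<exists>D>0. (K has_real_derivative D) (at x)"
      using w by (metis divide_pos_pos)
  qed
  then show ?thesis by (simp add: K_def)
qed

text \<open>Only the differential equations, signs and boundary values enter. \<open>E\<close> is 1
  at both ends, its derivative has the sign of \<open>J\<close>, and \<open>J\<close> is strictly
  increasing because \<open>K > 0\<close>.\<close>

lemma ode_energy_bound:
  fixes q u :: "real \<Rightarrow> real" and d :: real
  assumes "d \<ge> 1" and contq: "continuous_on {0..1} q" and contu: "continuous_on {0..1} u"
    and bdry: "q 0 = 1" "q 1 = 0" "u 0 = 0" "u 1 = 1"
    and qpos: "\<And>s. s \<in> {0<..<1} \<Longrightarrow> q s > 0"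
    and upos: "\<And>s. s \<in> {0<..<1} \<Longrightarrow> u s > 0"
    and qderiv: "\<And>s. s \<in> {0<..<1} \<Longrightarrow>
      (q has_real_derivative d * q s * (1 - 2 * s - q s) / (s * (1-s))) (at s)"
    and uderiv: "\<And>s. s \<in> {0<..<1} \<Longrightarrow>
      (u has_real_derivative u s * q s / (s * (1-s))) (at s)"
    and s: "s \<in> {0<..<1}"
  shows "q s ^ 2 + u s < 1"
proof (rule ccontr)
  define E where "E = (\<lambda>s. q s ^ 2 + u s)"
  define J where "J = (\<lambda>s. 1 - 2*d * q s * (q s - (1 - 2 * s)) / u s)"
  define K where
    "K = (\<lambda>s. 2*(2*d+1) * (q s - (1 - 2 * s)) ^ 2 + 2*(d+1) * (1-2 * s) * (q s - (1 - 2 * s)) - 4 * s * (1-s))"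
  assume "\<not> q s ^ 2 + u s < 1"
  then have Es: "E s \<ge> 1" by (simp add: E_def)
  have contE: "continuous_on {0..1} E"
    unfolding E_def by (intro continuous_intros contq contu)
  have Ederiv: "(E has_real_derivative q x * u x * J x / (x * (1-x))) (at x)"
    and Jderiv: "(J has_real_derivative d * q x * K x / (u x * (x * (1-x)))) (at x)"
    if x: "x \<in> {0<..<1}" for x
  proof -
    let ?w = "x * (1-x)" and ?m = "1 - 2*x"
    define Q where "Q = d * q x * (?m - q x) / ?w"
    define U where "U = u x * q x / ?w"
    have w: "?w > 0" and u: "u x > 0" using x upos by auto
    have Q: "Q * ?w = d * q x * (?m - q x)" and U: "U * ?w = u x * q x"
      using w by (auto simp: Q_def U_def)
    have dq: "(q has_real_derivative Q) (at x)" and du: "(u has_real_derivative U) (at x)"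
      unfolding Q_def U_def using x by (intro qderiv uderiv; simp)+
    have "(E has_real_derivative 2 * q x * Q + U) (at x)"
      unfolding E_def using dq du by (auto intro!: derivative_eq_intros)
    moreover have "2 * q x * Q + U = q x * u x * J x / ?w"
    proof -
      have "u x * J x = u x * 1 - u x * (2*d * q x * (q x - ?m) / u x)"
        by (simp only: J_def right_diff_distrib)
      also have "\<dots> = u x - 2*d * q x * (q x - ?m)"
        using u by simp
      finally have "(2 * q x * Q + U) * ?w = q x * (u x * J x)"
        using Q U by algebra
      then show ?thesis using w by (metis less_irrefl nonzero_eq_divide_eq mult.assoc)
    qed
    ultimately show "(E has_real_derivative q x * u x * J x / ?w) (at x)" by simp
    \<comment> \<open>Numerator of the quotient rule for \<open>q * (q - m) / u\<close>; the summand
      2 comes from differentiating \<open>- (1 - 2 * x)\<close>.\<close>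
    define N where "N = (Q * (q x - ?m) + q x * (Q + 2)) * u x - q x * (q x - ?m) * U"
    have "(J has_real_derivative - (2*d * N / (u x)^2)) (at x)"
      unfolding J_def N_def using dq du u
      by (auto intro!: derivative_eq_intros simp: power2_eq_square algebra_simps)
    moreover have "- (2*d * N / (u x)^2) = d * q x * K x / (u x * ?w)"
    proof -
      have "- (2*d * N * ?w) = d * q x * K x * u x"
        using Q U unfolding N_def K_def by algebra
      moreover have "- (a / v^2) = b / (v * c)" if "- (a * c) = b * v" "v > 0" "c > 0" for a b c v :: real
        using that by (simp add: field_simps power2_eq_square)
      ultimately show ?thesis using w u by blast
    qed
    ultimately show "(J has_real_derivative d * q x * K x / (u x * ?w)) (at x)" by simp
  qed
  have Jmono: "J x < J y" if "0 < x" "x < y" "y < 1" for x y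
  proof (rule DERIV_pos_imp_increasing[OF \<open>x < y\<close>])
    fix z assume "x \<le> z" "z \<le> y"
    then have z: "z \<in> {0<..<1}" using that by auto
    have "K z > 0"
      unfolding K_def
      using ode_quadratic_bound[OF \<open>d \<ge> 1\<close> contq bdry(1) qpos qderiv z] by simp
    then have "d * q z * K z / (u z * (z * (1-z))) > 0"
      using z qpos[OF z] upos[OF z] \<open>d \<ge> 1\<close> by simp
    then show "\<exists>D. (J has_real_derivative D) (at z) \<and> 0 < D"
      using Jderiv[OF z] by blast
  qed
  show False
  \<comment> \<open>The sign of \<open>J s\<close> decides which end point to compare with:
    \<open>E\<close> either increases strictly from \<open>s\<close> to 1 or decreases strictly from
    0 to \<open>s\<close>, so \<open>E s < 1\<close> in both cases.\<close>
  proof (cases "J s \<ge> 0")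
    case True
    have "E s < E 1"
    proof (rule DERIV_pos_imp_increasing_open[of s 1 E])
      show "s < 1" using s by simp
      show "continuous_on {s..1} E"
        using contE by (rule continuous_on_subset) (use s in auto)
      fix x assume x: "s < x" "x < 1"
      then have x': "x \<in> {0<..<1}" using s by simp
      have "J x > 0" using Jmono[of s x] x s True by simp
      then have "q x * u x * J x / (x * (1-x)) > 0"
        using qpos[OF x'] upos[OF x'] x' by simp
      then show "\<exists>D. (E has_real_derivative D) (at x) \<and> D > 0"
        using Ederiv[OF x'] by blast
    qed
    then show False using Es bdry by (simp add: E_def)
  next
    case False
    have "E 0 > E s"
    proof (rule DERIV_neg_imp_decreasing_open[of 0 s E])
      show "0 < s" using s by simp
      show "continuous_on {0..s} E"
        using contE by (rule continuous_on_subset) (use s in auto)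
      fix x assume x: "0 < x" "x < s"
      then have x': "x \<in> {0<..<1}" using s by simp
      have "J x < 0" using Jmono[of x s] x s False by simp
      then have "q x * u x * J x / (x * (1-x)) < 0"
        using qpos[OF x'] upos[OF x'] x' by (simp add: divide_neg_pos mult_pos_neg)
      then show "\<exists>D. (E has_real_derivative D) (at x) \<and> D < 0"
        using Ederiv[OF x'] by blast
    qed
    then show False using Es bdry by (simp add: E_def)
  qed
qed

section \<open>The incomplete Beta function with equal integer parameters\<close>

text \<open>The two integrands can differ only at 0 and 1, where \<open>0 ^ 0 = 1\<close> but
  \<open>0 powr 0 = 0\<close>.\<close>

lemma inc_Beta_nat:
  fixes d :: nat
  assumes "d \<ge> 1" "s \<in> {0..1}"
  shows "inc_Beta s d d = integral {0..s} (\<lambda>t. t ^ (d-1) * (1 - t) ^ (d-1))"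
  unfolding inc_Beta_def
proof (rule integral_spike)
  show "negligible {0, 1::real}" by simp
  fix t :: real assume "t \<in> {0..s} - {0, 1}"
  then show "t ^ (d-1) * (1 - t) ^ (d-1) = t powr (real d - 1) * (1 - t) powr (real d - 1)"
    using assms by (simp add: powr_realpow[symmetric] of_nat_diff)
qed

lemma inc_Beta_nat_deriv:
  fixes d :: nat
  assumes "d \<ge> 1" "s \<in> {0..1}"
  shows "((\<lambda>x. inc_Beta x d d) has_real_derivative s ^ (d-1) * (1-s) ^ (d-1)) (at s within {0..1})"
proof -
  have "((\<lambda>x. integral {0..x} (\<lambda>t. t ^ (d-1) * (1 - t) ^ (d-1))) has_real_derivative
      s ^ (d-1) * (1-s) ^ (d-1)) (at s within {0..1})"
    by (rule integral_has_real_derivative[OF _ assms(2)]) (intro continuous_intros)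
  then show ?thesis
    by (rule has_field_derivative_transform_within[of _ _ _ _ 1])
       (use assms in \<open>auto simp: inc_Beta_nat\<close>)
qed

text \<open>On \<open>{0..s}\<close> the factor \<open>(1 - t) ^ (d-1)\<close> lies between
  \<open>(1 - s) ^ (d-1)\<close> and 1, and \<open>t ^ (d-1)\<close> integrates to
  \<open>s ^ d / d\<close>. These bounds give the limit of \<open>q\<close> at 0.\<close>

lemma inc_Beta_nat_bounds:
  fixes d :: nat
  assumes "d \<ge> 1" "s \<in> {0..1}"
  shows "s ^ d * (1-s) ^ (d-1) \<le> d * inc_Beta s d d" "d * inc_Beta s d d \<le> s ^ d"
proof -
  have pow: "((\<lambda>t. t ^ (d-1)) has_integral s ^ d / d) {0..s}"
  proof -
    have "((\<lambda>t. t ^ (d-1)) has_integral s ^ d / d - 0 ^ d / d) {0..s}"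
    proof (rule fundamental_theorem_of_calculus)
      show "0 \<le> s" using assms by simp
      fix x assume "x \<in> {0..s}"
      show "((\<lambda>t. t ^ d / d) has_vector_derivative x ^ (d-1)) (at x within {0..s})"
        unfolding has_real_derivative_iff_has_vector_derivative[symmetric]
        by (rule derivative_eq_intros refl | use assms in simp)+
    qed
    then show ?thesis using assms by (simp add: power_0_left)
  qed
  have F: "((\<lambda>t. t ^ (d-1) * (1 - t) ^ (d-1)) has_integral inc_Beta s d d) {0..s}"
    unfolding inc_Beta_nat[OF assms]
    by (intro integrable_integral integrable_continuous_real continuous_intros)
  have "inc_Beta s d d \<le> s ^ d / d"
    by (rule has_integral_le[OF F pow]) (use assms in \<open>auto intro!: mult_left_le power_le_one\<close>)
  then show "d * inc_Beta s d d \<le> s ^ d"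
    using assms by (simp add: field_simps)
  have "s ^ d / d * (1-s) ^ (d-1) \<le> inc_Beta s d d"
    by (rule has_integral_le[OF has_integral_mult_left[OF pow] F])
       (use assms in \<open>auto intro!: mult_left_mono power_mono\<close>)
  then show "s ^ d * (1-s) ^ (d-1) \<le> d * inc_Beta s d d"
    using assms by (simp add: field_simps)
qed

lemma inc_Beta_nat_pos:
  fixes d :: nat
  assumes "d \<ge> 1" "s \<in> {0<..<1}"
  shows "inc_Beta s d d > 0"
proof -
  have "0 < s ^ d * (1-s) ^ (d-1)" using assms by simp
  also have "\<dots> \<le> d * inc_Beta s d d"
    by (rule inc_Beta_nat_bounds) (use assms in auto)
  finally show ?thesis using assms by (simp add: zero_less_mult_iff)
qed

lemma Beta_real_pos:
  fixes a b :: real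
  assumes "a > 0" "b > 0"
  shows "Beta a b > 0"
  using assms unfolding Beta_def by (intro divide_pos_pos mult_pos_pos Gamma_real_pos) auto

section \<open>The inequality and its equality cases\<close>

text \<open>The functions \<open>q\<close> and \<open>u\<close> below satisfy the hypotheses of
  \<open>ode_energy_bound\<close>. Taking roots in \<open>q s ^ 2 < 1 - u s\<close> and multiplying
  by \<open>d * F s\<close> gives the claim.\<close>

lemma inc_Beta_nat_strict_bound:
  fixes d :: nat
  assumes d: "d \<ge> 1" and s: "s \<in> {0<..<1}"
  shows "s ^ d * (1 - s) ^ d < d * inc_Beta s d d * sqrt (1 - reg_inc_Beta s d d powr (1 / d))"
proof -
  define F where "F = (\<lambda>x. inc_Beta x d d)"
  define B where "B = Beta (real d) (real d)"
  \<comment> \<open>At 0 the quotient is 0/0, which evaluates to 0; the value 1 is the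
    limit.\<close>
  define q where "q = (\<lambda>x::real. if x = 0 then 1 else x ^ d * (1-x) ^ d / (d * F x))"
  define u where "u = (\<lambda>x. (F x / B) powr (1 / d))"
  have Fpos: "F x > 0" if "x \<in> {0<..<1}" for x
    unfolding F_def by (rule inc_Beta_nat_pos[OF d that])
  have B: "B > 0"
    using d unfolding B_def by (intro Beta_real_pos) auto
  have F1: "F 1 = B" unfolding F_def B_def by (rule inc_Beta_1) (use d in auto)
  have F0: "F 0 = 0" by (simp add: F_def inc_Beta_def)
  have contF: "continuous_on {0..1} F"
    unfolding F_def continuous_on_eq_continuous_within
    using inc_Beta_nat_deriv[OF d] by (blast intro: DERIV_continuous)
  have Fderiv: "(F has_real_derivative x ^ (d-1) * (1-x) ^ (d-1)) (at x)" if "x \<in> {0<..<1}" for x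
    using inc_Beta_nat_deriv[OF d, of x] that
    by (simp add: F_def at_within_Icc_at)
  have Fge: "F x \<ge> 0" if "x \<in> {0..1}" for x
    using Fpos[of x] F0 F1 B that by (cases "x = 0"; cases "x = 1") auto
  obtain n where n: "d = Suc n" using d by (cases d) auto
  have "q s ^ 2 + u s < 1"
  proof (rule ode_energy_bound[of "real d" q u, OF _ _ _ _ _ _ _ _ _ _ _ s])
    show "real d \<ge> 1" using d by simp
    show "q 0 = 1" "q 1 = 0" "u 0 = 0" "u 1 = 1"
      using B d by (simp_all add: q_def u_def F0 F1)
    show "q x > 0" "u x > 0" if "x \<in> {0<..<1}" for x
      using Fpos[OF that] B d that by (auto simp: q_def u_def)
    show "continuous_on {0..1} u"
      unfolding u_def using B d Fge
      by (intro continuous_on_powr' continuous_intros contF) auto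
    show "(u has_real_derivative u x * q x / (x * (1-x))) (at x)" if x: "x \<in> {0<..<1}" for x
    proof -
      have "(u has_real_derivative (1 / d) * (F x / B) powr (1 / d - 1) * (x ^ n * (1-x) ^ n / B)) (at x)"
        unfolding u_def
        by (rule derivative_eq_intros Fderiv[OF x] refl | use B Fpos[OF x] n in simp)+
      moreover have "(F x / B) powr (1 / d - 1) = u x / (F x / B)"
        using B Fpos[OF x] by (simp add: u_def powr_diff)
      moreover have "(1 / d) * (u x / (F x / B)) * (x ^ n * (1-x) ^ n / B) = u x * q x / (x * (1-x))"
      proof -
        \<comment> \<open>Stated for arbitrary reals, so that \<open>field_simps\<close> treats
          powers and function values as plain variables.\<close>
        have "(1 / a) * (v / (f / b)) * (p / b) = v * (w * p / (a * f)) / w"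
          if "a \<noteq> 0" "f \<noteq> 0" "b \<noteq> 0" "w \<noteq> 0" for a v f b p w :: real
          using that by (simp add: field_simps)
        from this[of "real d" "F x" B "x * (1-x)" "u x" "x ^ n * (1-x) ^ n"]
        show ?thesis using x B d Fpos[OF x] by (simp add: q_def n mult_ac)
      qed
      ultimately show ?thesis by simp
    qed
    show "(q has_real_derivative d * q x * (1 - 2*x - q x) / (x * (1-x))) (at x)"
      if x: "x \<in> {0<..<1}" for x
    proof -
      \<comment> \<open>\<open>f\<close> is the derivative of \<open>F\<close> at \<open>x\<close>,
        and it also divides the numerator of \<open>q\<close>, which is
        \<open>(x * (1-x)) ^ d\<close>.\<close>
      define f where "f = x ^ n * (1-x) ^ n"
      have f: "x ^ d * (1-x) ^ d = x * (1-x) * f"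
        by (simp add: f_def n)
      have "((\<lambda>x. x ^ d * (1-x) ^ d) has_real_derivative d * f * (1 - 2*x)) (at x)"
      proof -
        have "((\<lambda>x. x * (1-x)) has_real_derivative 1 - 2*x) (at x)"
          by (auto intro!: derivative_eq_intros)
        from DERIV_power[OF this, of d] show ?thesis
          by (simp add: f_def n power_mult_distrib mult_ac del: of_nat_Suc power_Suc)
      qed
      moreover have "((\<lambda>x. d * F x) has_real_derivative d * f) (at x)"
        using DERIV_cmult[OF Fderiv[OF x]] by (simp add: f_def n)
      ultimately have "((\<lambda>x. x ^ d * (1-x) ^ d / (d * F x)) has_real_derivative
          (d * f * (1 - 2*x) * (d * F x) - x * (1-x) * f * (d * f)) / (d * F x * (d * F x))) (at x)"
        using DERIV_divide[of _ _ x UNIV "\<lambda>x. d * F x"] Fpos[OF x] d f by fastforce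
      moreover have "(d * f * (1 - 2*x) * (d * F x) - x * (1-x) * f * (d * f)) / (d * F x * (d * F x))
          = d * q x * (1 - 2*x - q x) / (x * (1-x))"
      proof -
        have "(a * f * m * (a * b) - w * f * (a * f)) / (a * b * (a * b))
            = a * (w * f / (a * b)) * (m - w * f / (a * b)) / w"
          if "a \<noteq> 0" "b \<noteq> 0" "w \<noteq> 0" for a b w m :: real
          using that by (simp add: field_simps)
        moreover have "q x = x * (1-x) * f / (d * F x)"
          using x f by (simp add: q_def)
        ultimately show ?thesis using x d Fpos[OF x] by simp
      qed
      ultimately have "((\<lambda>x. x ^ d * (1-x) ^ d / (d * F x)) has_real_derivative
          d * q x * (1 - 2*x - q x) / (x * (1-x))) (at x)"
        by simp
      then show ?thesis
        by (rule has_field_derivative_transform_within_open[of _ _ _ "{0<..<1}"]) (use x in \<open>auto simp: q_def\<close>)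
    qed
    have Fpos': "F x > 0" if "x \<in> {0<..1}" for x
      using Fpos[of x] F1 B that by (cases "x = 1") auto
    show "continuous_on {0..1} q"
      unfolding continuous_on_eq_continuous_within
    proof
      fix x :: real assume x: "x \<in> {0..1}"
      show "continuous (at x within {0..1}) q"
      proof (cases "x = 0")
        case False
        have "continuous (at x within {0..1}) (\<lambda>x. x ^ d * (1-x) ^ d / (d * F x))"
          using contF x False Fpos'[of x] d
          by (intro continuous_intros) (auto simp: continuous_on_eq_continuous_within)
        then show ?thesis
          by (rule continuous_transform_within[of _ _ _ x]) (use x False in \<open>auto simp: q_def dist_real_def\<close>)
      next
        case True
        \<comment> \<open>Dividing \<open>y ^ d * (1-y) ^ d\<close> by the upper and lower bounds
          for \<open>d * F y\<close> encloses \<open>q y\<close> between two functions tending to 1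
          at 0.\<close>
        have bounds: "(1-y) ^ d \<le> q y" "q y \<le> 1 - y" if y: "y \<in> {0..1}" for y
        proof -
          have "(1-y) ^ d \<le> q y \<and> q y \<le> 1 - y"
          proof (cases "y = 0")
            case False
            then have F: "real d * F y > 0" using Fpos'[of y] y d by simp
            have "(1-y) ^ d * (d * F y) \<le> (1-y) ^ d * y ^ d"
              using inc_Beta_nat_bounds(2)[OF d y] y by (intro mult_left_mono) (auto simp: F_def)
            moreover have "(1-y) * (y ^ d * (1-y) ^ (d-1)) \<le> (1-y) * (d * F y)"
              using inc_Beta_nat_bounds(1)[OF d y] y by (intro mult_left_mono) (auto simp: F_def)
            ultimately show ?thesis
              using F False by (simp add: q_def n pos_le_divide_eq pos_divide_le_eq mult_ac)
          qed (simp add: q_def)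
          then show "(1-y) ^ d \<le> q y" "q y \<le> 1 - y" by auto
        qed
        have "(q \<longlongrightarrow> 1) (at 0 within {0..1})"
        proof (rule tendsto_sandwich)
          show "\<forall>\<^sub>F y in at 0 within {0..1}. (1-y) ^ d \<le> q y"
            "\<forall>\<^sub>F y in at 0 within {0..1}. q y \<le> 1 - y"
            using bounds by (auto simp: eventually_at_filter)
          show "((\<lambda>y::real. (1-y) ^ d) \<longlongrightarrow> 1) (at 0 within {0..1})"
            by (rule tendsto_eq_intros refl | simp)+
          show "((\<lambda>y::real. 1 - y) \<longlongrightarrow> 1) (at 0 within {0..1})"
            by (rule tendsto_eq_intros refl | simp)+
        qed
        then show ?thesis using True by (simp add: continuous_within q_def)
      qed
    qed
  qed
  then have "q s < sqrt (1 - u s)"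
    by (intro real_less_rsqrt) simp
  moreover have "real d * F s > 0" using Fpos[OF s] d by simp
  ultimately have "s ^ d * (1-s) ^ d < d * F s * sqrt (1 - u s)"
    using s by (simp add: q_def pos_divide_less_eq mult_ac)
  then show ?thesis by (simp add: F_def u_def B_def reg_inc_Beta_def)
qed

theorem theorem6p1:
  fixes d :: nat and s :: real
  assumes "d \<ge> 1" and "s \<in> {0..1}"
  shows "real d * inc_Beta s (real d) (real d) * sqrt (1 - reg_inc_Beta s (real d) (real d) powr (1 / real d))
           \<ge> s ^ d * (1 - s) ^ d
       \<and> (real d * inc_Beta s (real d) (real d) * sqrt (1 - reg_inc_Beta s (real d) (real d) powr (1 / real d))
           = s ^ d * (1 - s) ^ d \<longleftrightarrow> s = 0 \<or> s = 1)"
proof -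
  \<comment> \<open>Both sides vanish at the end points: the integral is 0 at \<open>s = 0\<close>,
    the square root is 0 at \<open>s = 1\<close>, and \<open>d \<ge> 1\<close> makes
    \<open>0 ^ d = 0\<close>. Strictness in between rules out further equality.\<close>
  consider "s = 0" | "s = 1" | "s \<in> {0<..<1}" using assms(2) by fastforce
  then show ?thesis
  proof cases
    case 1
    then show ?thesis using assms by (simp add: inc_Beta_def power_0_left)
  next
    case 2
    have "Beta (real d) (real d) \<noteq> 0"
      using Beta_real_pos[of d d] assms by simp
    then show ?thesis using 2 assms by (simp add: inc_Beta_1 reg_inc_Beta_def power_0_left)
  next
    case 3
    then show ?thesis using inc_Beta_nat_strict_bound[OF assms(1) 3] by auto
  qed
qed

end
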